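(* Let $\varphi:\mathbb{R}\to\mathbb{R}$ be a limiter satisfying $$\max(0,r)\le\varphi(r)\le1\ (r\le1),\qquad 1\le\varphi(r)\le\min(r,2)\ (r\ge1),\qquad \varphi(r)\le r\,\varphi(1/r)\ (r\ge1),$$ $$\varphi(r)\le(\alpha-2)\,r\ (r\le0),\qquad\varphi(r)\le\alpha\ (r>0)$$ for some real $\alpha$ with $1\le\alpha\le2$, and $$\frac{\varphi(r)}{r}\le M\qquad\text{for all }r>0$$ for some $M>0$. Let $\Phi:\mathbb{R}^2\to\mathbb{R}$ be a monotone consistent numerical flux, absolutely continuous with respect to each variable. Let $\Delta t,\Delta x>0$, let $(u_j^n)_{j\in\mathbb{Z}}$ be a real sequence with $\sum_j|u_{j+1}^n-u_j^n|<\infty$ and let $(u_j^{n+1})_{j\in\mathbb{Z}}$ be given by the first order scheme $$\frac1{\Delta t}(u_j^{n+1}-u_j^n)+\frac1{\Delta x}\Big(\Phi(u_{j+1/2}^{n,-},u_{j+1/2}^{n,+})-\Phi(u_{j-1/2}^{n,-},u_{j-1/2}^{n,+})\Big)=0\qquad(j\in\mathbb{Z}).$$ If the Courant-Friedrichs-Lewy condition $$\frac{\Delta t}{\Delta x}\big(|\alpha_{j+1/2}^n|+|\beta_{j+1/2}^n|\big)\le\frac1{1+\frac M2}\qquad\text{for all }j\in\mathbb{Z}$$ holds, then the scheme is total variation diminishing: $$\sum_{j\in\mathbb{Z}}|u_{j+1}^{n+1}-u_j^{n+1}|\le\sum_{j\in\mathbb{Z}}|u_{j+1}^n-u_j^n|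 .$$
   Context: $\Phi$ is consistent with a convex $C^2$ function $f:\mathbb{R}\to\mathbb{R}$ if $\Phi(u,u)=f(u)$, and monotone if it is nondecreasing in its first and nonincreasing in its second argument. Interpolation: for $\varphi:\mathbb{R}\to\mathbb{R}$, put $L_\varphi(u,v,w)=v+\frac12\varphi\big(\frac{v-u}{w-v}\big)(w-v)$ if $w\neq v$, $L_\varphi(u,v,v)=v$, and $R_\varphi(u,v,w)=L_\varphi(w,v,u)$. For a real sequence $(u_j)$: $u_{j+1/2}^-=L_\varphi(u_{j-1},u_j,u_{j+1})$, $u_{j+1/2}^+=R_\varphi(u_j,u_{j+1},u_{j+2})$; $u_{j+1/2}^{n,\pm}$ are these values for the sequence $(u_j^n)$. Partial gradients of the flux (at time level $n$): $\alpha_{j-1/2}$ and $\beta_{j+1/2}$ are the mean values of $\Phi_u$ and $\Phi_v$ defined by $$\Phi(u_{j+1/2}^-,u_{j-1/2}^+)-\Phi(u_{j-1/2}^-,u_{j-1/2}^+)=\alpha_{j-1/2}\,(u_{j+1/2}^--u_{j-1/2}^-),$$ $$\Phi(u_{j+1/2}^-,u_{j+1/2}^+)-\Phi(u_{j+1/2}^-,u_{j-1/2}^+)=\beta_{j+1/2}\,(u_{j+1/2}^+-u_{j-1/2}^+),$$ with the convention that the coefficient is $0$ when the difference it multiplies vanishes. *)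

theory Defs
  imports "HOL-Analysis.Analysis"
begin

definition C2_real :: "(real \<Rightarrow> real) \<Rightarrow> bool" where
  "C2_real f \<longleftrightarrow> f C1_differentiable_on UNIV \<and> deriv f C1_differentiable_on UNIV"

definition absolutely_continuous_on_interval :: "(real \<Rightarrow> real) \<Rightarrow> real \<Rightarrow> real \<Rightarrow> bool" where
  "absolutely_continuous_on_interval g c d \<longleftrightarrow>
     (\<forall>\<epsilon>>0. \<exists>\<delta>>0. \<forall>(n::nat) (a :: nat \<Rightarrow> real) (b :: nat \<Rightarrow> real).
        (\<forall>i<n. c \<le> a i \<and> a i \<le> b i \<and> b i \<le> d) \<longrightarrow>
        (\<forall>i<n. \<forall>k<n. i \<noteq> k \<longrightarrow> {a i<..<b i} \<inter> {a k<..<b k} = {}) \<longrightarrow>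
        (\<Sum>i<n. b i - a i) < \<delta> \<longrightarrow>
        (\<Sum>i<n. \<bar>g (b i) - g (a i)\<bar>) < \<epsilon>)"

(* Absolute continuity of a function on the whole line is understood locally, i.e. on every
   compact interval (globally it would exclude fluxes of quadratic growth). *)
definition loc_absolutely_continuous :: "(real \<Rightarrow> real) \<Rightarrow> bool" where
  "loc_absolutely_continuous g \<longleftrightarrow> (\<forall>c d. absolutely_continuous_on_interval g c d)"

definition consistent_flux :: "(real \<Rightarrow> real \<Rightarrow> real) \<Rightarrow> (real \<Rightarrow> real) \<Rightarrow> bool" where
  "consistent_flux \<Phi> f \<longleftrightarrow> (\<forall>u. \<Phi> u u = f u)"

definition monotone_flux :: "(real \<Rightarrow> real \<Rightarrow> real) \<Rightarrow> bool" where
  "monotone_flux \<Phi> \<longleftrightarrow> (\<forall>v. mono (\<lambda>u. \<Phi> u v)) \<and> (\<forall>u. antimono (\<lambda>v. \<Phi> u v))"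

definition flux_abs_continuous :: "(real \<Rightarrow> real \<Rightarrow> real) \<Rightarrow> bool" where
  "flux_abs_continuous \<Phi> \<longleftrightarrow>
     (\<forall>v. loc_absolutely_continuous (\<lambda>u. \<Phi> u v)) \<and>
     (\<forall>u. loc_absolutely_continuous (\<lambda>v. \<Phi> u v))"

definition interpL :: "(real \<Rightarrow> real) \<Rightarrow> real \<Rightarrow> real \<Rightarrow> real \<Rightarrow> real" where
  "interpL \<phi> u v w = (if w \<noteq> v then v + 1/2 * \<phi> ((v - u) / (w - v)) * (w - v) else v)"

definition interpR :: "(real \<Rightarrow> real) \<Rightarrow> real \<Rightarrow> real \<Rightarrow> real \<Rightarrow> real" where
  "interpR \<phi> u v w = interpL \<phi> w v u"

(* Quantities with half-integer index j + 1/2 are indexed by the integer j: below,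
   uminus_half \<phi> u j, uplus_half \<phi> u j, alpha_half \<Phi> \<phi> u j and beta_half \<Phi> \<phi> u j stand for
   u^-, u^+, alpha and beta at j + 1/2, so that the index j - 1/2 becomes j - 1. *)

definition uminus_half :: "(real \<Rightarrow> real) \<Rightarrow> (int \<Rightarrow> real) \<Rightarrow> int \<Rightarrow> real" where
  "uminus_half \<phi> u j = interpL \<phi> (u (j - 1)) (u j) (u (j + 1))"

definition uplus_half :: "(real \<Rightarrow> real) \<Rightarrow> (int \<Rightarrow> real) \<Rightarrow> int \<Rightarrow> real" where
  "uplus_half \<phi> u j = interpR \<phi> (u j) (u (j + 1)) (u (j + 2))"

definition alpha_half :: "(real \<Rightarrow> real \<Rightarrow> real) \<Rightarrow> (real \<Rightarrow> real) \<Rightarrow> (int \<Rightarrow> real) \<Rightarrow> int \<Rightarrow> real" where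
  "alpha_half \<Phi> \<phi> u j =
     (if uminus_half \<phi> u (j + 1) - uminus_half \<phi> u j = 0 then 0
      else (\<Phi> (uminus_half \<phi> u (j + 1)) (uplus_half \<phi> u j)
            - \<Phi> (uminus_half \<phi> u j) (uplus_half \<phi> u j))
           / (uminus_half \<phi> u (j + 1) - uminus_half \<phi> u j))"

definition beta_half :: "(real \<Rightarrow> real \<Rightarrow> real) \<Rightarrow> (real \<Rightarrow> real) \<Rightarrow> (int \<Rightarrow> real) \<Rightarrow> int \<Rightarrow> real" where
  "beta_half \<Phi> \<phi> u j =
     (if uplus_half \<phi> u j - uplus_half \<phi> u (j - 1) = 0 then 0
      else (\<Phi> (uminus_half \<phi> u j) (uplus_half \<phi> u j)
            - \<Phi> (uminus_half \<phi> u j) (uplus_half \<phi> u (j - 1)))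
           / (uplus_half \<phi> u j - uplus_half \<phi> u (j - 1)))"

(* The difference quotients satisfy the equations that characterise the mean partial gradients. *)

lemma alpha_half_eq:
  "\<Phi> (uminus_half \<phi> u j) (uplus_half \<phi> u (j - 1))
     - \<Phi> (uminus_half \<phi> u (j - 1)) (uplus_half \<phi> u (j - 1))
   = alpha_half \<Phi> \<phi> u (j - 1) * (uminus_half \<phi> u j - uminus_half \<phi> u (j - 1))"
  by (simp add: alpha_half_def)

lemma beta_half_eq:
  "\<Phi> (uminus_half \<phi> u j) (uplus_half \<phi> u j)
     - \<Phi> (uminus_half \<phi> u j) (uplus_half \<phi> u (j - 1))
   = beta_half \<Phi> \<phi> u j * (uplus_half \<phi> u j - uplus_half \<phi> u (j - 1))"
  by (simp add: beta_half_def)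

definition first_order_step ::
  "(real \<Rightarrow> real \<Rightarrow> real) \<Rightarrow> (real \<Rightarrow> real) \<Rightarrow> real \<Rightarrow> real \<Rightarrow> (int \<Rightarrow> real) \<Rightarrow> (int \<Rightarrow> real) \<Rightarrow> bool" where
  "first_order_step \<Phi> \<phi> dt dx u u' \<longleftrightarrow>
     (\<forall>j. 1 / dt * (u' j - u j)
        + 1 / dx * (\<Phi> (uminus_half \<phi> u j) (uplus_half \<phi> u j)
                    - \<Phi> (uminus_half \<phi> u (j - 1)) (uplus_half \<phi> u (j - 1))) = 0)"

end

theory Submission
  imports Defs
begin

text \<open>Write \<open>d j = u (j + 1) - u j\<close>. The growth conditions on the limiter ensure that the jump of
  the interpolated values across a cell is a multiple of a jump of the sequence, with a factor
  between \<open>0\<close> and \<open>1 + M / 2\<close> (lemma \<open>interpL_diff_eq_mult\<close>; for the right interpolation it is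
  applied to the reflected sequence). The difference of two numerical fluxes splits into a change
  of the first and a change of the second argument, so the scheme has Harten's incremental form
  \<open>u' j = u j - C (j - 1) * d (j - 1) + D j * d j\<close>.

  Monotonicity of the flux gives \<open>C j \<ge> 0\<close> and \<open>D j \<ge> 0\<close>. Both coefficients with index \<open>j\<close> belong
  to the interface \<open>j + 1/2\<close>, so the CFL condition there yields \<open>C j + D j \<le> 1\<close>. Hence
  \<open>\<bar>u' (j + 1) - u' j\<bar>\<close> is at most
  \<open>(1 - C j - D j) * \<bar>d j\<bar> + C (j - 1) * \<bar>d (j - 1)\<bar> + D (j + 1) * \<bar>d (j + 1)\<bar>\<close>.
  When this is summed over \<open>j\<close>, after an index shift in the last two terms, the coefficient of
  \<open>\<bar>d j\<bar>\<close> adds up to \<open>1\<close> (lemma \<open>harten_tvd\<close>).\<close>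

lemma bij_shift_int: "bij (\<lambda>j::int. j + k)"
  by (rule bij_betw_byWitness[where f' = "\<lambda>j. j - k"]) auto

lemma harten_tvd:
  fixes v v' C D :: "int \<Rightarrow> real"
  assumes tv: "(\<lambda>j. \<bar>v (j + 1) - v j\<bar>) summable_on UNIV"
    and C: "\<And>j. 0 \<le> C j" and D: "\<And>j. 0 \<le> D j" and CD: "\<And>j. C j + D j \<le> 1"
    and v': "\<And>j. v' j = v j - C (j - 1) * (v j - v (j - 1)) + D j * (v (j + 1) - v j)"
  shows "(\<lambda>j. \<bar>v' (j + 1) - v' j\<bar>) summable_on UNIV"
    and "(\<Sum>\<^sub>\<infinity>j. \<bar>v' (j + 1) - v' j\<bar>) \<le> (\<Sum>\<^sub>\<infinity>j. \<bar>v (j + 1) - v j\<bar>)"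
proof -
  define d where "d j = \<bar>v (j + 1) - v j\<bar>" for j
  have d: "d summable_on UNIV"
    using tv by (simp add: d_def[abs_def])
  have weighted: "(\<lambda>j. w j * d j) summable_on UNIV" if "\<And>j. 0 \<le> w j" "\<And>j. w j \<le> 1" for w
    by (rule summable_on_comparison_test[OF d])
      (use that in \<open>auto simp: d_def intro: mult_left_le_one_le\<close>)
  have sC: "(\<lambda>j. C j * d j) summable_on UNIV" and sD: "(\<lambda>j. D j * d j) summable_on UNIV"
    and sE: "(\<lambda>j. (1 - C j - D j) * d j) summable_on UNIV"
  proof -
    have "C j \<le> 1" "D j \<le> 1" "0 \<le> 1 - C j - D j" "1 - C j - D j \<le> 1" for j
      using C[of j] D[of j] CD[of j] by linarith+
    then show "(\<lambda>j. C j * d j) summable_on UNIV" "(\<lambda>j. D j * d j) summable_on UNIV"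
      "(\<lambda>j. (1 - C j - D j) * d j) summable_on UNIV"
      using C D by (intro weighted; simp)+
  qed
  have shC: "((\<lambda>j. C (j - 1) * d (j - 1)) has_sum (\<Sum>\<^sub>\<infinity>j. C j * d j)) UNIV"
    using has_sum_reindex_bij_betw[OF bij_shift_int[of "-1"], of "\<lambda>j. C j * d j"] has_sum_infsum[OF sC]
    by simp
  have shD: "((\<lambda>j. D (j + 1) * d (j + 1)) has_sum (\<Sum>\<^sub>\<infinity>j. D j * d j)) UNIV"
    using has_sum_reindex_bij_betw[OF bij_shift_int[of 1], of "\<lambda>j. D j * d j"] has_sum_infsum[OF sD]
    by simp
  define B where "B j = (1 - C j - D j) * d j + C (j - 1) * d (j - 1) + D (j + 1) * d (j + 1)" for j
  have "(B has_sum (\<Sum>\<^sub>\<infinity>j. (1 - C j - D j) * d j) + (\<Sum>\<^sub>\<infinity>j. C j * d j) + (\<Sum>\<^sub>\<infinity>j. D j * d j)) UNIV"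
    unfolding B_def by (intro has_sum_add has_sum_infsum[OF sE] shC shD)
  also have "(\<Sum>\<^sub>\<infinity>j. (1 - C j - D j) * d j) + (\<Sum>\<^sub>\<infinity>j. C j * d j) + (\<Sum>\<^sub>\<infinity>j. D j * d j) = (\<Sum>\<^sub>\<infinity>j. d j)"
  proof -
    have "((\<lambda>j. (1 - C j - D j) * d j + C j * d j + D j * d j) has_sum
        (\<Sum>\<^sub>\<infinity>j. (1 - C j - D j) * d j) + (\<Sum>\<^sub>\<infinity>j. C j * d j) + (\<Sum>\<^sub>\<infinity>j. D j * d j)) UNIV"
      by (intro has_sum_add has_sum_infsum sC sD sE)
    moreover have "(1 - C j - D j) * d j + C j * d j + D j * d j = d j" for j
      by (simp add: algebra_simps)
    ultimately show ?thesis
      by (simp add: infsumI)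
  qed
  finally have B: "(B has_sum (\<Sum>\<^sub>\<infinity>j. d j)) UNIV" .
  have le: "\<bar>v' (j + 1) - v' j\<bar> \<le> B j" for j
  proof -
    have "v' (j + 1) - v' j = (1 - C j - D j) * (v (j + 1) - v j)
        + C (j - 1) * (v j - v (j - 1)) + D (j + 1) * (v (j + 1 + 1) - v (j + 1))"
      by (simp add: v' algebra_simps)
    also have "\<bar>\<dots>\<bar> \<le> \<bar>(1 - C j - D j) * (v (j + 1) - v j)\<bar>
        + \<bar>C (j - 1) * (v j - v (j - 1))\<bar> + \<bar>D (j + 1) * (v (j + 1 + 1) - v (j + 1))\<bar>"
      by linarith
    also have "\<dots> = B j"
      using C[of "j - 1"] D[of "j + 1"] CD[of j] by (simp add: B_def d_def abs_mult)
    finally show ?thesis .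
  qed
  show summ: "(\<lambda>j. \<bar>v' (j + 1) - v' j\<bar>) summable_on UNIV"
    by (rule summable_on_comparison_test[OF has_sum_imp_summable[OF B]]) (use le in auto)
  have "(\<Sum>\<^sub>\<infinity>j. \<bar>v' (j + 1) - v' j\<bar>) \<le> (\<Sum>\<^sub>\<infinity>j. d j)"
    by (rule has_sum_mono[OF has_sum_infsum[OF summ] B]) (rule le)
  then show "(\<Sum>\<^sub>\<infinity>j. \<bar>v' (j + 1) - v' j\<bar>) \<le> (\<Sum>\<^sub>\<infinity>j. \<bar>v (j + 1) - v j\<bar>)"
    by (simp add: d_def)
qed

text \<open>If no increment vanishes, put \<open>r = (c - b) / (d - c)\<close> and \<open>s = (b - a) / (c - b)\<close>. The factor
  is then \<open>1 + (\<phi> r / r - \<phi> s) / 2\<close>: it is nonnegative since \<open>\<phi> r / r \<ge> \<alpha> - 2\<close> and \<open>\<phi> s \<le> \<alpha>\<close>, and at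
  most \<open>1 + M / 2\<close> since \<open>\<phi> r / r \<le> M\<close> and \<open>\<phi> s \<ge> 0\<close>.\<close>

lemma interpL_diff_eq_mult:
  fixes \<phi> :: "real \<Rightarrow> real"
  assumes nonneg: "\<And>r. 0 \<le> \<phi> r" and le_\<alpha>: "\<And>r. \<phi> r \<le> \<alpha>" and "\<alpha> \<le> 2" and "0 \<le> M"
    and neg: "\<And>r. r \<le> 0 \<Longrightarrow> \<phi> r \<le> (\<alpha> - 2) * r"
    and pos: "\<And>r. r > 0 \<Longrightarrow> \<phi> r / r \<le> M"
  shows "\<exists>A. 0 \<le> A \<and> A \<le> 1 + M / 2 \<and> interpL \<phi> b c d - interpL \<phi> a b c = A * (c - b)"
proof (cases "c = b")
  case True
  \<comment> \<open>The limiter in \<open>interpL \<phi> b c d\<close> then has argument \<open>0\<close>, where it vanishes.\<close>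
  have "\<phi> 0 = 0"
    using nonneg[of 0] neg[of 0] by simp
  with True show ?thesis
    using \<open>0 \<le> M\<close> by (intro exI[of _ 0]) (auto simp: interpL_def)
next
  case False
  define s where "s = (b - a) / (c - b)"
  have L_abc: "interpL \<phi> a b c = b + \<phi> s / 2 * (c - b)"
    using False by (simp add: interpL_def s_def)
  show ?thesis
  proof (cases "d = c")
    case True
    have "interpL \<phi> b c d - interpL \<phi> a b c = (1 - \<phi> s / 2) * (c - b)"
      unfolding L_abc by (simp add: True interpL_def algebra_simps)
    then show ?thesis
      using nonneg[of s] le_\<alpha>[of s] \<open>\<alpha> \<le> 2\<close> \<open>0 \<le> M\<close> by (intro exI[of _ "1 - \<phi> s / 2"]) auto
  next
    case d: False
    define r where "r = (c - b) / (d - c)"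
    have "r \<noteq> 0" and r: "d - c = (c - b) / r"
      using False d by (auto simp: r_def)
    have L_bcd: "interpL \<phi> b c d = c + \<phi> r / r / 2 * (c - b)"
    proof -
      have "interpL \<phi> b c d = c + \<phi> r / 2 * (d - c)"
        using d by (simp add: interpL_def r_def)
      also have "\<dots> = c + \<phi> r / r / 2 * (c - b)"
        by (subst r) simp
      finally show ?thesis .
    qed
    have bounds: "\<alpha> - 2 \<le> \<phi> r / r" "\<phi> r / r \<le> M"
    proof -
      consider "r > 0" | "r < 0"
        using \<open>r \<noteq> 0\<close> by linarith
      then have "\<alpha> - 2 \<le> \<phi> r / r \<and> \<phi> r / r \<le> M"
      proof cases
        case 1
        then have "0 \<le> \<phi> r / r"
          using nonneg by simp
        then show ?thesis
          using pos[OF 1] \<open>\<alpha> \<le> 2\<close> by linarith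
      next
        case 2
        then have "\<phi> r / r \<le> 0"
          using nonneg by (simp add: divide_nonneg_neg)
        moreover have "\<alpha> - 2 \<le> \<phi> r / r"
          using neg[of r] 2 by (simp add: neg_le_divide_eq)
        ultimately show ?thesis
          using \<open>0 \<le> M\<close> by linarith
      qed
      then show "\<alpha> - 2 \<le> \<phi> r / r" "\<phi> r / r \<le> M"
        by auto
    qed
    define A where "A = 1 + (\<phi> r / r - \<phi> s) / 2"
    have "interpL \<phi> b c d - interpL \<phi> a b c = A * (c - b)"
      unfolding L_abc L_bcd A_def by (simp add: algebra_simps diff_divide_distrib)
    moreover have "0 \<le> A \<and> A \<le> 1 + M / 2"
      using bounds nonneg[of s] le_\<alpha>[of s] unfolding A_def by argo
    ultimately show ?thesis
      by blast
  qed
qed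

lemma alpha_half_nonneg:
  assumes "monotone_flux \<Phi>"
  shows "0 \<le> alpha_half \<Phi> \<phi> u j"
proof -
  have "x \<le> y \<Longrightarrow> \<Phi> x w \<le> \<Phi> y w" for x y w
    using assms by (auto simp: monotone_flux_def dest: monoD)
  then show ?thesis
    by (cases "uminus_half \<phi> u (j + 1) \<le> uminus_half \<phi> u j")
      (auto simp: alpha_half_def zero_le_divide_iff)
qed

lemma beta_half_nonpos:
  assumes "monotone_flux \<Phi>"
  shows "beta_half \<Phi> \<phi> u j \<le> 0"
proof -
  have "x \<le> y \<Longrightarrow> \<Phi> w y \<le> \<Phi> w x" for x y w
    using assms by (auto simp: monotone_flux_def dest: antimonoD)
  then show ?thesis
    by (cases "uplus_half \<phi> u j \<le> uplus_half \<phi> u (j - 1)")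
      (auto simp: beta_half_def divide_le_0_iff)
qed

theorem proposition5p1:
  fixes \<phi> :: "real \<Rightarrow> real"
    and \<alpha> M :: real
    and f :: "real \<Rightarrow> real"
    and \<Phi> :: "real \<Rightarrow> real \<Rightarrow> real"
    and dt dx :: real
    and u u' :: "int \<Rightarrow> real"
  assumes "\<And>r. r \<le> 1 \<Longrightarrow> max 0 r \<le> \<phi> r \<and> \<phi> r \<le> 1"
    and "\<And>r. r \<ge> 1 \<Longrightarrow> 1 \<le> \<phi> r \<and> \<phi> r \<le> min r 2"
    and "\<And>r. r \<ge> 1 \<Longrightarrow> \<phi> r \<le> r * \<phi> (1 / r)"
    and "1 \<le> \<alpha>" and "\<alpha> \<le> 2"
    and "\<And>r. r \<le> 0 \<Longrightarrow> \<phi> r \<le> (\<alpha> - 2) * r"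
    and "\<And>r. r > 0 \<Longrightarrow> \<phi> r \<le> \<alpha>"
    and "M > 0"
    and "\<And>r. r > 0 \<Longrightarrow> \<phi> r / r \<le> M"
    and "convex_on UNIV f" and "C2_real f"
    and "consistent_flux \<Phi> f"
    and "monotone_flux \<Phi>"
    and "flux_abs_continuous \<Phi>"
    and "dt > 0" and "dx > 0"
    and "(\<lambda>j. \<bar>u (j + 1) - u j\<bar>) summable_on UNIV"
    and "first_order_step \<Phi> \<phi> dt dx u u'"
    and "\<And>j. dt / dx * (\<bar>alpha_half \<Phi> \<phi> u j\<bar> + \<bar>beta_half \<Phi> \<phi> u j\<bar>) \<le> 1 / (1 + M / 2)"
  shows "(\<lambda>j. \<bar>u' (j + 1) - u' j\<bar>) summable_on UNIV \<and>
         (\<Sum>\<^sub>\<infinity>j. \<bar>u' (j + 1) - u' j\<bar>) \<le> (\<Sum>\<^sub>\<infinity>j. \<bar>u (j + 1) - u j\<bar>)"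
proof -
  note lim_le1 = assms(1) and lim_ge1 = assms(2) and \<alpha> = assms(4,5) and lim_neg = assms(6)
    and lim_pos = assms(7) and M = assms(8,9) and mono = assms(13) and dtdx = assms(15,16)
    and tv = assms(17) and step = assms(18) and cfl = assms(19)
  have nonneg: "0 \<le> \<phi> r" for r
    using lim_le1[of r] lim_ge1[of r] by fastforce
  have le_\<alpha>: "\<phi> r \<le> \<alpha>" for r
    using lim_pos[of r] lim_le1[of r] \<alpha> by fastforce
  note diff = interpL_diff_eq_mult[of \<phi> \<alpha> M, OF nonneg le_\<alpha> \<alpha>(2) less_imp_le[OF M(1)] lim_neg M(2)]
  have "\<exists>A. 0 \<le> A \<and> A \<le> 1 + M / 2 \<and>
      uminus_half \<phi> u (j + 1) - uminus_half \<phi> u j = A * (u (j + 1) - u j)" for j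
    using diff[of "u j" "u (j + 1)" "u (j + 2)" "u (j - 1)"]
    by (simp add: uminus_half_def add.assoc)
  then obtain A where A: "\<And>j. 0 \<le> A j" "\<And>j. A j \<le> 1 + M / 2"
    and A_eq: "\<And>j. uminus_half \<phi> u (j + 1) - uminus_half \<phi> u j = A j * (u (j + 1) - u j)"
    by metis
  \<comment> \<open>Reflection: \<open>interpR\<close> is \<open>interpL\<close> on the stencil read from right to left.\<close>
  have "\<exists>B. 0 \<le> B \<and> B \<le> 1 + M / 2 \<and>
      uplus_half \<phi> u j - uplus_half \<phi> u (j - 1) = B * (u (j + 1) - u j)" for j
  proof -
    obtain B where "0 \<le> B" "B \<le> 1 + M / 2" and B: "interpL \<phi> (u (j + 1)) (u j) (u (j - 1))
        - interpL \<phi> (u (j + 2)) (u (j + 1)) (u j) = B * (u j - u (j + 1))"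
      using diff by blast
    moreover have "uplus_half \<phi> u j - uplus_half \<phi> u (j - 1) = B * (u (j + 1) - u j)"
      using B by (simp add: uplus_half_def interpR_def algebra_simps)
    ultimately show ?thesis
      by blast
  qed
  then obtain B where B: "\<And>j. 0 \<le> B j" "\<And>j. B j \<le> 1 + M / 2"
    and B_eq: "\<And>j. uplus_half \<phi> u j - uplus_half \<phi> u (j - 1) = B j * (u (j + 1) - u j)"
    by metis
  define c where "c = dt / dx"
  have "0 \<le> c"
    using dtdx by (simp add: c_def)
  define C where "C j = c * alpha_half \<Phi> \<phi> u j * A j" for j
  define D where "D j = c * (- beta_half \<Phi> \<phi> u j) * B j" for j
  have "0 \<le> C j" for j
    unfolding C_def by (intro mult_nonneg_nonneg \<open>0 \<le> c\<close> A alpha_half_nonneg[OF mono])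
  moreover have "0 \<le> D j" for j
    using beta_half_nonpos[OF mono, of \<phi> u j]
    unfolding D_def by (intro mult_nonneg_nonneg \<open>0 \<le> c\<close> B) simp
  moreover have "C j + D j \<le> 1" for j
  proof -
    have "C j \<le> c * \<bar>alpha_half \<Phi> \<phi> u j\<bar> * (1 + M / 2)"
      unfolding C_def by (intro mult_mono mult_nonneg_nonneg A \<open>0 \<le> c\<close>)
        (auto simp: alpha_half_nonneg[OF mono])
    moreover have "D j \<le> c * \<bar>beta_half \<Phi> \<phi> u j\<bar> * (1 + M / 2)"
      unfolding D_def by (intro mult_mono mult_nonneg_nonneg B \<open>0 \<le> c\<close>)
        (auto simp: beta_half_nonpos[OF mono])
    ultimately have "C j + D j \<le> c * (\<bar>alpha_half \<Phi> \<phi> u j\<bar> + \<bar>beta_half \<Phi> \<phi> u j\<bar>) * (1 + M / 2)"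
      by (simp add: algebra_simps)
    also have "\<dots> \<le> 1"
      using cfl[of j] M(1) by (simp add: c_def pos_le_divide_eq)
    finally show ?thesis .
  qed
  moreover have "u' j = u j - C (j - 1) * (u j - u (j - 1)) + D j * (u (j + 1) - u j)" for j
  proof -
    have "u' j = u j - c * (\<Phi> (uminus_half \<phi> u j) (uplus_half \<phi> u j)
        - \<Phi> (uminus_half \<phi> u (j - 1)) (uplus_half \<phi> u (j - 1)))"
      using step[unfolded first_order_step_def, rule_format, of j] dtdx
      by (simp add: c_def field_simps)
    also have "\<dots> = u j - c * (alpha_half \<Phi> \<phi> u (j - 1) * (A (j - 1) * (u j - u (j - 1)))
        + beta_half \<Phi> \<phi> u j * (B j * (u (j + 1) - u j)))"
      using alpha_half_eq[of \<Phi> \<phi> u j] beta_half_eq[of \<Phi> \<phi> u j] A_eq[of "j - 1"] B_eq[of j]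
      by simp
    finally show ?thesis
      by (simp add: C_def D_def algebra_simps)
  qed
  ultimately show ?thesis
    using harten_tvd[OF tv, of C D u'] by blast
qed

end
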